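(* Let $m,n$ be positive integers, let $1<p_1<p_2\le\dots\le p_{m-1}<p_m$ be real numbers, and let $\lambda_i>0$ and $r_i\in\{2,p_i\}$ for each $i\in\{1,\dots,m\}$. Consider the function $\sum_{i=1}^m\lambda_i\|\cdot\|_{r_i}^{p_i}:\mathbb{R}^n\to\mathbb{R}$ and the functions $|\cdot|^{p_1},|\cdot|^{p_m}:\mathbb{R}\to\mathbb{R}$. Then $$\alpha\left(\sum_{i=1}^m\lambda_i\|\cdot\|_{r_i}^{p_i}\right)=\min\{\alpha(|\cdot|^{p_1}),\alpha(|\cdot|^{p_m})\}.$$
   Context: The condition $p_1<p_2\le\dots\le p_{m-1}<p_m$ means that the sequence is nondecreasing with its first inequality and its last inequality strict (for $m=2$ it reads $p_1<p_2$). For $r>1$, $\|x\|_r=(\sum_{j=1}^n|x_j|^r)^{1/r}$. For a differentiable strictly convex function $h:\mathbb{R}^d\to\mathbb{R}$, the Bregman distance is $D_h(x,y):=h(x)-h(y)-\langle\nabla h(y),x-y\rangle$ and the symmetry coefficient is $$\alpha(h):=\inf\left\{\frac{D_h(x,y)}{D_h(y,x)}\;\middle|\;x,y\in\mathbb{R}^d,\ x\neq y\right\}.$$ All functions in the claim are differentiable and strictly convex on their (full) domain. *)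

theory Defs
  imports "HOL-Analysis.Analysis"
begin

definition lr_norm :: "real \<Rightarrow> real ^ 'n \<Rightarrow> real" where
  "lr_norm r x = (\<Sum>j\<in>UNIV. \<bar>x $ j\<bar> powr r) powr (1 / r)"

(* Meaningful only where h is differentiable; gradient_eqI shows that the
   description is then unique. *)
definition gradient :: "('a::real_inner \<Rightarrow> real) \<Rightarrow> 'a \<Rightarrow> 'a" where
  "gradient h y = (THE g. GDERIV h y :> g)"

lemma gradient_eqI:
  assumes "GDERIV h y :> g"
  shows "gradient h y = g"
proof -
  have "g' = g" if "GDERIV h y :> g'" for g'
  proof -
    have "(\<lambda>v. v \<bullet> g') = (\<lambda>v. v \<bullet> g)"
      using that assms unfolding gderiv_def by (rule has_derivative_unique)
    then have "v \<bullet> g' = v \<bullet> g" for v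
      by (rule fun_cong)
    then show ?thesis
      using vector_eq_ldot by blast
  qed
  with assms show ?thesis
    unfolding gradient_def by blast
qed

definition bregman :: "('a::real_inner \<Rightarrow> real) \<Rightarrow> 'a \<Rightarrow> 'a \<Rightarrow> real" where
  "bregman h x y = h x - h y - gradient h y \<bullet> (x - y)"

(* For h differentiable and strictly convex on a nontrivial space, both Bregman
   distances are positive when x and y are distinct, so the infimum is that of a
   nonempty set of positive reals. *)
definition symmetry_coeff :: "('a::real_inner \<Rightarrow> real) \<Rightarrow> real" where
  "symmetry_coeff h = Inf {bregman h x y / bregman h y x | x y. x \<noteq> y}"

end

theory Submission
  imports Defs
begin

text \<open>
  Write \<open>D\<^sub>p(x, y)\<close> for the Bregman distance of \<open>\<bar>\<cdot>\<bar>\<^sup>p\<close> on the real line. A number \<open>a\<close> is a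
  lower bound of the symmetry coefficient of \<open>h\<close> exactly when
  \<open>a * D\<^sub>h(y, x) \<le> D\<^sub>h(x, y)\<close> for all \<open>x\<close>, \<open>y\<close> (\<open>symmetry_coeff_bound\<close>,
  \<open>symmetry_coeff_greatest\<close>). Such inequalities can be added and scaled, so for the lower bound
  it suffices to treat each summand \<open>\<parallel>\<cdot>\<parallel>\<^sub>r\<^sup>p\<close> of the sum separately. If \<open>r = p\<close>, the summand is
  itself a sum of one-dimensional powers of the coordinates. If \<open>r = 2\<close>, the difference
  \<open>D(x, y) - a * D(y, x)\<close> depends, for fixed lengths of \<open>x\<close> and \<open>y\<close>, affinely on the cosine of
  the angle between them; hence it is nonnegative as soon as it is so for collinear vectors, which
  is again the one-dimensional case (\<open>bregman_norm_powr_symmetry\<close>).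

  What remains is that for \<open>p \<le> r \<le> q\<close> the coefficient of \<open>\<bar>\<cdot>\<bar>\<^sup>r\<close> is at least the smaller of those
  of \<open>\<bar>\<cdot>\<bar>\<^sup>p\<close> and \<open>\<bar>\<cdot>\<bar>\<^sup>q\<close>. This holds pointwise: for \<open>\<bar>x\<bar> \<ge> \<bar>y\<bar>\<close> the ratio \<open>D\<^sub>p(x, y) / D\<^sub>p(y, x)\<close>
  decreases with \<open>p\<close> (\<open>power_bregman_ratio_mono\<close>), hence for \<open>\<bar>x\<bar> \<le> \<bar>y\<bar>\<close> it increases, so the
  ratio for \<open>r\<close> always dominates one of the ratios for \<open>p\<close> and \<open>q\<close>. By homogeneity one may take
  \<open>y = 1\<close>, and then the ratio is an explicit decreasing function of a quantity of Stolarsky mean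
  type, whose monotonicity in the exponent is \<open>stolarsky_mono\<close> (for \<open>x > 0\<close>) and
  \<open>stolarsky_mono_plus\<close> (for \<open>x < 0\<close>).

  For the upper bound, restrict the sum to a coordinate axis and scale both points by \<open>s > 0\<close>. The
  \<open>i\<close>-th term of the Bregman distance is multiplied by \<open>s\<close> to the power \<open>p\<^sub>i\<close>, so the ratio tends
  to that of the smallest exponent as \<open>s \<rightarrow> 0\<close> and to that of the largest as \<open>s \<rightarrow> \<infinity>\<close>
  (\<open>dominant_term_le\<close>). Here the strict first and last inequalities between the exponents isolate a single dominant term.
\<close>

abbreviation power_bregman :: "real \<Rightarrow> real \<Rightarrow> real \<Rightarrow> real" where
  "power_bregman p \<equiv> bregman (\<lambda>t. \<bar>t\<bar> powr p)"

text \<open>These hold at \<open>x = 0\<close> as well, because \<open>0 powr a = 0\<close> for every exponent \<open>a\<close>.\<close>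

lemma powr_shift:
  fixes x :: real
  assumes "0 \<le> x"
  shows "x powr (p - 1) * x = x powr p"
    and "x powr (p - 2) * x = x powr (p - 1)"
    and "x powr (p - 2) * (x * x) = x powr p"
proof -
  have step: "x powr a * x = x powr (a + 1)" for a
    using powr_mult_base[OF assms, of a] by (simp add: ac_simps)
  show "x powr (p - 1) * x = x powr p" "x powr (p - 2) * x = x powr (p - 1)"
    by (simp_all add: step)
  then show "x powr (p - 2) * (x * x) = x powr p"
    by (simp only: mult.assoc[symmetric])
qed

section \<open>Calculus of Bregman distances\<close>

lemma GDERIV_sum:
  assumes "\<And>i. i \<in> I \<Longrightarrow> GDERIV (h i) y :> g i"
  shows "GDERIV (\<lambda>x. \<Sum>i\<in>I. c i * h i x) y :> (\<Sum>i\<in>I. c i *\<^sub>R g i)"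
proof -
  have "((\<lambda>x. \<Sum>i\<in>I. c i * h i x) has_derivative (\<lambda>v. \<Sum>i\<in>I. c i * (v \<bullet> g i))) (at y)"
    using assms unfolding gderiv_def
    by (intro has_derivative_sum has_derivative_mult_right) auto
  then show ?thesis
    unfolding gderiv_def by (simp add: inner_sum_right)
qed

lemma bregman_sum:
  assumes "\<And>i y. i \<in> I \<Longrightarrow> \<exists>g. GDERIV (h i) y :> g"
  shows "bregman (\<lambda>x. \<Sum>i\<in>I. c i * h i x) x y = (\<Sum>i\<in>I. c i * bregman (h i) x y)"
proof -
  have "GDERIV (h i) y :> gradient (h i) y" if "i \<in> I" for i
    using assms[OF that] gradient_eqI by metis
  then have "gradient (\<lambda>x. \<Sum>i\<in>I. c i * h i x) y = (\<Sum>i\<in>I. c i *\<^sub>R gradient (h i) y)"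
    by (intro gradient_eqI GDERIV_sum) auto
  then show ?thesis
    by (simp add: bregman_def inner_sum_left sum_subtractf right_diff_distrib)
qed

lemma GDERIV_compose_inner:
  fixes f :: "real \<Rightarrow> real"
  assumes "GDERIV f (y \<bullet> e) :> g"
  shows "GDERIV (\<lambda>x. f (x \<bullet> e)) y :> g *\<^sub>R e"
proof -
  have "((\<lambda>x. f (x \<bullet> e)) has_derivative (\<lambda>v. (v \<bullet> e) \<bullet> g)) (at y)"
    using has_derivative_compose[OF has_derivative_inner_left[OF has_derivative_ident]
        assms[unfolded gderiv_def]] .
  then show ?thesis
    unfolding gderiv_def by (simp add: mult.commute)
qed

text \<open>A function of one linear coordinate has the Bregman distance of its profile; this identifies
  the summands \<open>\<bar>x\<^sub>j\<bar>\<^sup>p\<close> of \<open>\<parallel>x\<parallel>\<^sub>p\<^sup>p\<close>.\<close>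

lemma bregman_compose_inner:
  fixes f :: "real \<Rightarrow> real"
  assumes "GDERIV f (y \<bullet> e) :> g"
  shows "bregman (\<lambda>x. f (x \<bullet> e)) x y = bregman f (x \<bullet> e) (y \<bullet> e)"
proof -
  have "gradient (\<lambda>x. f (x \<bullet> e)) y = g *\<^sub>R e" "gradient f (y \<bullet> e) = g"
    using gradient_eqI[OF GDERIV_compose_inner[OF assms]] gradient_eqI[OF assms] by auto
  moreover have "(g *\<^sub>R e) \<bullet> (x - y) = g \<bullet> (x \<bullet> e - y \<bullet> e)"
    by (simp add: inner_commute[of e "x - y"] inner_diff_left)
  ultimately show ?thesis
    by (simp only: bregman_def)
qed

text \<open>Away from \<open>0\<close> this is the chain rule. At \<open>0\<close> the right-hand side vanishes, and
  \<open>\<parallel>x\<parallel>\<^sup>p = o(\<parallel>x\<parallel>)\<close> because \<open>p > 1\<close>.\<close>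

lemma GDERIV_norm_powr:
  fixes y :: "'a::real_inner"
  assumes "1 < p"
  shows "GDERIV (\<lambda>x. norm x powr p) y :> (p * norm y powr (p - 2)) *\<^sub>R y"
proof (cases "y = 0")
  case False
  have "GDERIV (\<lambda>x. norm x powr p) y :> (p * norm y powr (p - 1)) *\<^sub>R sgn y"
    by (rule GDERIV_DERIV_compose[OF GDERIV_norm[OF False] has_real_derivative_powr])
      (use False in simp)
  moreover have "norm y powr (p - 1) * inverse (norm y) = norm y powr (p - 2)"
    using False powr_shift(2)[OF norm_ge_zero, of y p] by (simp add: field_simps)
  ultimately show ?thesis
    by (simp add: sgn_div_norm mult.assoc)
next
  case True
  have "((\<lambda>h::'a. norm h powr (p - 1)) \<longlongrightarrow> 0) (at 0)"
    using assms by (intro tendsto_zero_powrI[where b = "p - 1"] tendsto_norm_zero tendsto_intros) auto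
  moreover have "norm h powr (p - 1) = norm h powr p / norm h" for h :: 'a
    by (cases "h = 0") (auto simp: powr_diff)
  ultimately show ?thesis
    using True by (simp add: gderiv_def has_derivative_at)
qed

lemma bregman_norm_powr:
  fixes x y :: "'a::real_inner"
  assumes "1 < p"
  shows "bregman (\<lambda>x. norm x powr p) x y =
    norm x powr p + (p - 1) * norm y powr p - p * norm y powr (p - 2) * (x \<bullet> y)"
proof -
  have "norm y powr (p - 2) * (y \<bullet> y) = norm y powr p"
    using powr_shift(3)[OF norm_ge_zero, of y p]
    by (simp only: power2_eq_square[symmetric] power2_norm_eq_inner)
  then show ?thesis
    by (simp add: bregman_def gradient_eqI[OF GDERIV_norm_powr[OF assms]]
        algebra_simps inner_diff_right inner_commute)
qed

lemmas GDERIV_abs_powr = GDERIV_norm_powr[where 'a = real, unfolded real_norm_def]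
lemmas power_bregman_eq =
  bregman_norm_powr[where 'a = real, unfolded real_norm_def inner_real_def]

text \<open>Strict convexity of \<open>z\<^sup>p\<close> on the half-line, in the form that its graph lies above its tangent
  at \<open>t\<close>. The end point \<open>0\<close> is admitted for both \<open>s\<close> and \<open>t\<close>, which is why the proof uses the mean
  value theorem: it needs the derivative only strictly between the two points.\<close>

lemma powr_tangent_less:
  fixes s t :: real
  assumes "1 < p" "0 \<le> s" "0 \<le> t" "s \<noteq> t"
  shows "p * t powr (p - 1) * s < s powr p + (p - 1) * t powr p"
proof -
  define f where "f = (\<lambda>z. z powr p - p * t powr (p - 1) * z)"
  have cont: "continuous_on {a..b} f" if "0 \<le> a" for a b
    using that assms unfolding f_def by (intro continuous_intros continuous_on_powr') auto
  have der: "(f has_real_derivative p * (z powr (p - 1) - t powr (p - 1))) (at z)" if "0 < z" for z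
    using that unfolding f_def by (auto intro!: derivative_eq_intros simp: algebra_simps)
  have "f t < f s"
  proof (cases "t < s")
    case True
    obtain l z where z: "t < z" "z < s" "DERIV f z :> l" "f s - f t = (s - t) * l"
      using MVT[OF True cont] der assms by (metis order.strict_trans1 real_differentiable_def)
    then have "l = p * (z powr (p - 1) - t powr (p - 1))"
      using der[of z] assms DERIV_unique by fastforce
    moreover have "t powr (p - 1) < z powr (p - 1)"
      using z assms by (intro powr_less_mono2) auto
    ultimately have "0 < l"
      using assms by simp
    then show ?thesis
      using z(4) True by (smt (verit) mult_pos_pos)
  next
    case False
    then have st: "s < t"
      using assms by simp
    obtain l z where z: "s < z" "z < t" "DERIV f z :> l" "f t - f s = (t - s) * l"
      using MVT[OF st cont] der assms by (metis order.strict_trans1 real_differentiable_def)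
    then have "l = p * (z powr (p - 1) - t powr (p - 1))"
      using der[of z] assms DERIV_unique by fastforce
    moreover have "z powr (p - 1) < t powr (p - 1)"
      using z assms by (intro powr_less_mono2) auto
    ultimately have "l < 0"
      using assms by (simp add: mult_pos_neg)
    then show ?thesis
      using z(4) st by (smt (verit) mult_pos_neg)
  qed
  moreover have "t powr (p - 1) * t = t powr p"
    using assms by (intro powr_shift)
  ultimately show ?thesis
    unfolding f_def by (simp add: algebra_simps)
qed

text \<open>If the norms differ, strictness comes from \<open>powr_tangent_less\<close>; if they agree, it comes from
  the Cauchy-Schwarz inequality, which is strict for distinct vectors of equal length.\<close>

lemma bregman_norm_powr_pos:
  fixes x y :: "'a::real_inner"
  assumes "1 < p" "x \<noteq> y"
  shows "0 < bregman (\<lambda>x. norm x powr p) x y"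
proof -
  have p1: "norm y powr (p - 1) = norm y powr (p - 2) * norm y"
    by (simp add: powr_shift)
  have cs: "norm y powr (p - 2) * (x \<bullet> y) \<le> norm y powr (p - 2) * (norm y * norm x)"
    by (intro mult_left_mono) (use norm_cauchy_schwarz[of x y] in \<open>auto simp: mult.commute\<close>)
  show ?thesis
  proof (cases "norm x = norm y")
    case False
    have "p * (norm y powr (p - 2) * (x \<bullet> y)) \<le> p * (norm y powr (p - 2) * (norm y * norm x))"
      using assms(1) by (intro mult_left_mono[OF cs]) simp
    then have "p * norm y powr (p - 2) * (x \<bullet> y) \<le> p * norm y powr (p - 1) * norm x"
      by (simp only: p1 mult.assoc)
    then show ?thesis
      using powr_tangent_less[OF assms(1) norm_ge_zero norm_ge_zero False]
      unfolding bregman_norm_powr[OF assms(1)] by linarith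
  next
    case True
    then have y0: "0 < norm y"
      using assms(2) by auto
    have "0 < (x - y) \<bullet> (x - y)"
      using assms(2) by simp
    also have "\<dots> = 2 * ((norm y)\<^sup>2 - x \<bullet> y)"
      using True power2_norm_eq_inner[of x] power2_norm_eq_inner[of y]
      by (simp only: inner_diff_left inner_diff_right inner_commute[of y x]) simp
    finally have "0 < p * norm y powr (p - 2) * ((norm y)\<^sup>2 - x \<bullet> y)"
      using assms y0 by (intro mult_pos_pos) auto
    moreover have "norm y powr (p - 2) * (norm y)\<^sup>2 = norm y powr p"
      by (simp add: powr_shift power2_eq_square)
    ultimately show ?thesis
      using True assms by (simp add: bregman_norm_powr algebra_simps)
  qed
qed

lemmas power_bregman_pos =
  bregman_norm_powr_pos[where 'a = real, unfolded real_norm_def]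

lemma power_bregman_nonneg: "1 < p \<Longrightarrow> 0 \<le> power_bregman p x y"
  using power_bregman_pos[of p x y] by (cases "x = y") (auto simp: bregman_def)

section \<open>Reduction of the Euclidean norm to the line\<close>

text \<open>With \<open>c\<close> the cosine of the angle between \<open>x\<close> and \<open>y\<close>: the distance is affine in \<open>c\<close>, and the
  two one-dimensional distances are its values at \<open>c = 1\<close> and \<open>c = - 1\<close>.\<close>

lemma bregman_norm_powr_convex_combination:
  fixes x y :: "'a::real_inner"
  assumes "1 < p" and c: "x \<bullet> y = c * (norm x * norm y)"
  shows "bregman (\<lambda>x. norm x powr p) x y =
    (1 + c) / 2 * power_bregman p (norm x) (norm y) +
    (1 - c) / 2 * power_bregman p (norm x) (- norm y)"
  using assms by (simp add: bregman_norm_powr power_bregman_eq field_simps)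

text \<open>Exchanging \<open>x\<close> and \<open>y\<close> does not change the cosine, so both sides are convex combinations with
  the same weights, and the inequality on the line can be averaged.\<close>

lemma bregman_norm_powr_symmetry:
  fixes x y :: "'a::real_inner"
  assumes "1 < p" and a: "\<And>s t. a * power_bregman p t s \<le> power_bregman p s t"
  shows "a * bregman (\<lambda>x. norm x powr p) y x \<le> bregman (\<lambda>x. norm x powr p) x y"
proof -
  define c where "c = (x \<bullet> y) / (norm x * norm y)"
  \<comment> \<open>If one of the vectors is zero, division by zero gives \<open>c = 0\<close>, and this equation still holds.\<close>
  have c: "x \<bullet> y = c * (norm x * norm y)"
    by (auto simp: c_def)
  have "\<bar>c\<bar> \<le> 1"
    using Cauchy_Schwarz_ineq2[of x y] by (simp add: c_def abs_mult divide_le_eq)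
  then have c1: "0 \<le> (1 + c) / 2" "0 \<le> (1 - c) / 2"
    by auto
  have flip: "power_bregman p (norm y) (- norm x) = power_bregman p (- norm y) (norm x)"
    using assms(1) by (simp add: power_bregman_eq)
  have "a * bregman (\<lambda>x. norm x powr p) y x =
    (1 + c) / 2 * (a * power_bregman p (norm y) (norm x)) +
    (1 - c) / 2 * (a * power_bregman p (- norm y) (norm x))"
    using assms(1) c flip
    by (subst bregman_norm_powr_convex_combination[where c = c])
      (auto simp: algebra_simps inner_commute)
  also have "\<dots> \<le> (1 + c) / 2 * power_bregman p (norm x) (norm y) +
    (1 - c) / 2 * power_bregman p (norm x) (- norm y)"
    by (intro add_mono mult_left_mono a c1)
  also have "\<dots> = bregman (\<lambda>x. norm x powr p) x y"
    using bregman_norm_powr_convex_combination[OF assms(1) c] by simp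
  finally show ?thesis .
qed

section \<open>Monotonicity in the exponent\<close>

text \<open>The left-hand side is the barycentre \<open>c\<close> of the interval from \<open>1\<close> to \<open>t\<close> with respect to the
  density \<open>s\<^sup>p\<^sup>-\<^sup>2\<close>. Passing from \<open>p\<close> to \<open>q\<close> multiplies the density by the increasing function
  \<open>s\<^sup>q\<^sup>-\<^sup>p\<close>, which moves mass to the right. In formulas, \<open>s\<^sup>q\<^sup>-\<^sup>p (s - c) \<ge> c\<^sup>q\<^sup>-\<^sup>p (s - c)\<close> for \<open>s > 0\<close>,
  and the integral of the right-hand side against \<open>s\<^sup>p\<^sup>-\<^sup>2\<close> is zero. Integration is replaced below by
  the monotonicity of an antiderivative.\<close>

lemma stolarsky_mono:
  fixes t :: real
  assumes "1 < p" "p \<le> q" "1 < t"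
  shows "(p - 1) * (t powr p - 1) / (p * (t powr (p - 1) - 1))
    \<le> (q - 1) * (t powr q - 1) / (q * (t powr (q - 1) - 1))"
    (is "?m p \<le> ?m q")
proof -
  define c where "c = ?m p"
  \<comment> \<open>An antiderivative of \<open>s\<^sup>r\<^sup>-\<^sup>2 (s - c)\<close>; by the choice of \<open>c\<close> its values at \<open>1\<close> and \<open>t\<close> agree
    for \<open>r = p\<close>.\<close>
  define F where "F = (\<lambda>r s. s powr r / r - c * (s powr (r - 1) / (r - 1)))"
  have gt: "1 < t powr (p - 1)" "1 < t powr p" "1 < t powr (q - 1)"
    using assms by auto
  then have c0: "0 < c"
    using assms by (auto simp: c_def)
  have Fp: "F p t = F p 1"
    using assms gt by (simp add: F_def c_def) (simp add: field_simps)
  have derF: "(F r has_real_derivative s powr (r - 2) * (s - c)) (at s)" if "1 < r" "1 \<le> s" for r s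
  proof -
    have "(F r has_real_derivative
        r * s powr (r - 1) / r - c * ((r - 1) * s powr (r - 1 - 1) / (r - 1))) (at s)"
      using that unfolding F_def
      by (intro DERIV_diff DERIV_cmult DERIV_cdivide has_real_derivative_powr) auto
    moreover have "r * s powr (r - 1) / r - c * ((r - 1) * s powr (r - 1 - 1) / (r - 1)) =
        s powr (r - 1) - c * s powr (r - 2)"
      using that by simp
    moreover have "s powr (r - 1) = s powr (r - 2) * s"
      using that by (simp add: powr_shift)
    moreover have "s powr (r - 2) * s - c * s powr (r - 2) = s powr (r - 2) * (s - c)"
      by (simp add: algebra_simps)
    ultimately show ?thesis
      by (simp only:)
  qed
  have "F q 1 - c powr (q - p) * F p 1 \<le> F q t - c powr (q - p) * F p t"
  proof (rule DERIV_nonneg_imp_nondecreasing[where f = "\<lambda>s. F q s - c powr (q - p) * F p s"])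
    fix s assume s: "1 \<le> s" "s \<le> t"
    have "((\<lambda>s. F q s - c powr (q - p) * F p s) has_real_derivative
        s powr (q - 2) * (s - c) - c powr (q - p) * (s powr (p - 2) * (s - c))) (at s)"
      using assms s by (intro DERIV_diff DERIV_cmult derF) auto
    moreover have "s powr (q - 2) = s powr (q - p) * s powr (p - 2)"
      by (simp flip: powr_add)
    moreover have "0 \<le> s powr (p - 2) * ((s powr (q - p) - c powr (q - p)) * (s - c))"
    proof (cases "c \<le> s")
      case True
      then have "c powr (q - p) \<le> s powr (q - p)"
        using assms c0 by (intro powr_mono2) auto
      with True show ?thesis by simp
    next
      case False
      then have "s powr (q - p) \<le> c powr (q - p)"
        using assms s by (intro powr_mono2) auto
      with False show ?thesis by (simp add: mult_nonpos_nonpos)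
    qed
    ultimately show "\<exists>d. ((\<lambda>s. F q s - c powr (q - p) * F p s) has_real_derivative d) (at s) \<and> 0 \<le> d"
      by - (rule exI, rule conjI, assumption, simp add: algebra_simps)
  qed (use assms in auto)
  then have "F q 1 \<le> F q t"
    using Fp by simp
  then have "c * ((t powr (q - 1) - 1) / (q - 1)) \<le> (t powr q - 1) / q"
    by (simp add: F_def diff_divide_distrib algebra_simps)
  then have "c \<le> ?m q"
    using assms gt by (simp add: field_simps)
  then show ?thesis
    by (simp add: c_def)
qed

text \<open>Here the left-hand side is minus the barycentre of the interval from \<open>- t\<close> to \<open>1\<close> with respect to
  the density \<open>\<bar>s\<bar>\<^sup>p\<^sup>-\<^sup>2\<close>. It equals \<open>(1 - 1/p) * (t - (t + 1) / (t\<^sup>p\<^sup>-\<^sup>1 + 1))\<close>, where both factors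
  are nonnegative and increasing in \<open>p\<close>.\<close>

lemma stolarsky_mono_plus:
  fixes t :: real
  assumes "1 < p" "p \<le> q" "1 \<le> t"
  shows "(p - 1) * (t powr p - 1) / (p * (t powr (p - 1) + 1))
    \<le> (q - 1) * (t powr q - 1) / (q * (t powr (q - 1) + 1))"
proof -
  have factor: "(r - 1) * (t powr r - 1) / (r * (t powr (r - 1) + 1)) =
    (1 - 1 / r) * (t - (t + 1) / (t powr (r - 1) + 1))" if "1 < r" for r
  proof -
    have tr: "t powr r = t * t powr (r - 1)" and "0 < t powr (r - 1) + 1"
      using assms(3) powr_shift(1)[of t r] by (auto simp: mult.commute add_nonneg_pos)
    then show ?thesis
      unfolding tr using that by (simp add: divide_simps) (simp add: algebra_simps)
  qed
  have "t powr (p - 1) \<le> t powr (q - 1)" and ge1: "1 \<le> t powr (p - 1)"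
    using assms by (auto intro: powr_mono ge_one_powr_ge_zero)
  then have "(t + 1) / (t powr (q - 1) + 1) \<le> (t + 1) / (t powr (p - 1) + 1)"
    using assms by (intro divide_left_mono) auto
  moreover have "(t + 1) / (t powr (p - 1) + 1) \<le> t"
  proof -
    have "(t + 1) / (t powr (p - 1) + 1) \<le> (t + 1) / 2"
      using assms ge1 by (intro divide_left_mono) auto
    also have "\<dots> \<le> t"
      using assms by simp
    finally show ?thesis .
  qed
  moreover have "1 / q \<le> 1 / p"
    using assms by (simp add: frac_le)
  moreover have "1 / q \<le> 1" "1 / p \<le> 1"
    using assms by auto
  ultimately show ?thesis
    using assms by (subst (1 2) factor) (auto intro!: mult_mono)
qed

text \<open>Put \<open>t = \<bar>z\<bar>\<close> and let \<open>e\<close> be minus the sign of \<open>z\<close>. For \<open>z \<noteq> 1\<close> both distances are a common positive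
  factor \<open>A\<close> times a linear expression in one quantity \<open>\<nu>\<close>, so that
  \<open>D\<^sub>r(z, 1) / D\<^sub>r(1, z) = (t - \<nu>\<^sub>r) / (\<nu>\<^sub>r + e)\<close>, which decreases as \<open>\<nu>\<^sub>r\<close> grows. That \<open>\<nu>\<^sub>r\<close> grows
  with \<open>r\<close> is one of the two Stolarsky inequalities above, according to the sign of \<open>z\<close>.\<close>

lemma power_bregman_ratio_mono_unit:
  fixes z :: real
  assumes "1 < p" "p \<le> q" "1 \<le> \<bar>z\<bar>"
  shows "power_bregman q z 1 * power_bregman p 1 z \<le> power_bregman p z 1 * power_bregman q 1 z"
proof (cases "z = 1")
  case True
  then show ?thesis by (simp add: bregman_def)
next
  case False
  define t where "t = \<bar>z\<bar>"
  define e :: real where "e = (if 0 < z then - 1 else 1)"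
  define A where "A = (\<lambda>r. r * (t powr (r - 1) + e))"
  define \<nu> where "\<nu> = (\<lambda>r. (r - 1) * (t powr r - 1) / A r)"
  have t: "1 \<le> t" "e = - 1 \<Longrightarrow> 1 < t"
    using assms False by (auto simp: t_def e_def split: if_splits)
  have z: "z = - e * t" and e2: "e * e = 1" and e: "e = 1 \<or> e = - 1"
    using assms by (auto simp: t_def e_def)
  have A: "0 < A r" if "1 < r" for r
    using e
  proof
    assume "e = - 1"
    then have "1 < t powr (r - 1)"
      using t that by simp
    then show ?thesis
      using \<open>e = - 1\<close> that by (simp add: A_def)
  qed (use that in \<open>auto simp: A_def intro!: mult_pos_pos add_nonneg_pos\<close>)
  have \<nu>: "\<nu> p \<le> \<nu> q"
    using e t assms stolarsky_mono[of p q t] stolarsky_mono_plus[of p q t]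
    unfolding \<nu>_def A_def by auto
  have form: "power_bregman r z 1 = A r * (t - \<nu> r) \<and> power_bregman r 1 z = A r * (\<nu> r + e)"
    if r: "1 < r" for r
  proof -
    have t1: "t powr r = t * t powr (r - 1)" "t powr (r - 2) * t = t powr (r - 1)"
      using t powr_shift(1)[of t r] powr_shift(2)[of t r] by (auto simp: mult.commute)
    have A\<nu>: "A r * \<nu> r = (r - 1) * (t powr r - 1)"
      using A[OF r] by (simp add: \<nu>_def)
    have "power_bregman r z 1 = t powr r + (r - 1) + e * r * t"
      using r by (simp add: power_bregman_eq t_def[symmetric]) (simp add: z)
    also have "\<dots> = A r * t - A r * \<nu> r"
      unfolding A\<nu> by (simp add: A_def t1 algebra_simps)
    finally have 1: "power_bregman r z 1 = A r * (t - \<nu> r)"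
      by (simp add: algebra_simps)
    have "power_bregman r 1 z = 1 + (r - 1) * t powr r + e * r * (t powr (r - 2) * t)"
      using r by (simp add: power_bregman_eq t_def[symmetric]) (simp add: z)
    also have "\<dots> = A r * \<nu> r + r * (t powr (r - 1) * e + e * e)"
      unfolding A\<nu> t1(2) by (simp add: e2 algebra_simps)
    finally have 2: "power_bregman r 1 z = A r * (\<nu> r + e)"
      by (simp add: A_def algebra_simps)
    show ?thesis using 1 2 ..
  qed
  \<comment> \<open>This product is the difference of the two sides of the claim.\<close>
  have "0 \<le> A p * A q * ((t + e) * (\<nu> q - \<nu> p))"
    using A[of p] A[of q] \<nu> assms t e by (intro mult_nonneg_nonneg) auto
  then have "(A q * (t - \<nu> q)) * (A p * (\<nu> p + e)) \<le> (A p * (t - \<nu> p)) * (A q * (\<nu> q + e))"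
    by (simp add: algebra_simps)
  then show ?thesis
    using form[of p] form[of q] assms by simp
qed

lemma power_bregman_scale:
  assumes "1 < p"
  shows "power_bregman p (s * x) (s * y) = \<bar>s\<bar> powr p * power_bregman p x y"
proof -
  have "\<bar>s\<bar> powr (p - 2) * (s * s) = \<bar>s\<bar> powr p"
    using powr_shift(3)[OF abs_ge_zero, of s p] by simp
  then have cross: "p * \<bar>s * y\<bar> powr (p - 2) * (s * x * (s * y)) =
      \<bar>s\<bar> powr p * (p * \<bar>y\<bar> powr (p - 2) * (x * y))"
    by (simp add: abs_mult powr_mult algebra_simps)
  show ?thesis
    unfolding power_bregman_eq[OF assms] cross by (simp add: abs_mult powr_mult algebra_simps)
qed

text \<open>The ratio \<open>D\<^sub>p(x, y) / D\<^sub>p(y, x)\<close> decreases in \<open>p\<close> when \<open>\<bar>y\<bar> \<le> \<bar>x\<bar>\<close>, written without division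
  so that \<open>x = y\<close> is covered. For \<open>y = 0\<close> the ratio is \<open>1 / (p - 1)\<close>.\<close>

lemma power_bregman_ratio_mono:
  assumes "1 < p" "p \<le> q" "\<bar>y\<bar> \<le> \<bar>x\<bar>"
  shows "power_bregman q x y * power_bregman p y x \<le> power_bregman p x y * power_bregman q y x"
proof (cases "y = 0")
  case True
  have "\<bar>x\<bar> powr q * ((p - 1) * \<bar>x\<bar> powr p) \<le> \<bar>x\<bar> powr p * ((q - 1) * \<bar>x\<bar> powr q)"
    using mult_right_mono[of "p - 1" "q - 1" "\<bar>x\<bar> powr q * \<bar>x\<bar> powr p"] assms
    by (simp add: algebra_simps)
  then show ?thesis
    using True assms by (simp add: power_bregman_eq)
next
  case False
  define z where "z = x / y"
  have x: "x = y * z" "1 \<le> \<bar>z\<bar>"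
    using False assms by (auto simp: z_def)
  have sc: "power_bregman r x y = \<bar>y\<bar> powr r * power_bregman r z 1"
    "power_bregman r y x = \<bar>y\<bar> powr r * power_bregman r 1 z" if "1 < r" for r
    using power_bregman_scale[OF that, of y z 1] power_bregman_scale[OF that, of y 1 z] x by auto
  have "(\<bar>y\<bar> powr p * \<bar>y\<bar> powr q) * (power_bregman q z 1 * power_bregman p 1 z) \<le>
      (\<bar>y\<bar> powr p * \<bar>y\<bar> powr q) * (power_bregman p z 1 * power_bregman q 1 z)"
    using assms x by (intro mult_left_mono power_bregman_ratio_mono_unit) auto
  then show ?thesis
    using assms by (simp add: sc algebra_simps)
qed

section \<open>Symmetry coefficients of powers\<close>

text \<open>Positivity of the distances makes the set of ratios bounded below and allows clearing
  the denominator; the inequality so obtained also covers \<open>x = y\<close>.\<close>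

lemma symmetry_coeff_bound:
  assumes pos: "\<And>x y. x \<noteq> y \<Longrightarrow> 0 < bregman h x y"
  shows "symmetry_coeff h * bregman h y x \<le> bregman h x y"
proof (cases "x = y")
  case True
  then show ?thesis by (simp add: bregman_def)
next
  case False
  have "symmetry_coeff h \<le> bregman h x y / bregman h y x"
    unfolding symmetry_coeff_def
  proof (rule cInf_lower)
    show "bdd_below {bregman h x y / bregman h y x |x y. x \<noteq> y}"
      using pos by (intro bdd_belowI[where m = 0]) (force intro: divide_nonneg_nonneg less_imp_le)
  qed (use False in auto)
  then show ?thesis
    using pos[of y x] False by (simp add: pos_le_divide_eq)
qed

text \<open>The two distinct points ensure that the infimum is not that of the empty set.\<close>

lemma symmetry_coeff_greatest:
  fixes h :: "'a::real_inner \<Rightarrow> real"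
  assumes pos: "\<And>x y. x \<noteq> y \<Longrightarrow> 0 < bregman h x y"
    and bound: "\<And>x y. a * bregman h y x \<le> bregman h x y"
    and ne: "x0 \<noteq> (y0 :: 'a)"
  shows "a \<le> symmetry_coeff h"
  unfolding symmetry_coeff_def
proof (rule cInf_greatest)
  show "{bregman h x y / bregman h y x |x y. x \<noteq> y} \<noteq> {}"
    using ne by blast
  fix c assume "c \<in> {bregman h x y / bregman h y x |x y. x \<noteq> y}"
  then obtain x y where "c = bregman h x y / bregman h y x" "x \<noteq> y"
    by blast
  then show "a \<le> c"
    using pos[of y x] bound[of y x] by (simp add: pos_le_divide_eq)
qed

text \<open>At points with \<open>\<bar>y\<bar> \<le> \<bar>x\<bar>\<close> the ratio for \<open>r\<close> is at least the one for the larger exponent \<open>q\<close>,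
  and at all other points at least the one for the smaller exponent \<open>p\<close>.\<close>

lemma power_bregman_symmetry_between:
  assumes "1 < p" "p \<le> r" "r \<le> q"
  shows "min (symmetry_coeff (\<lambda>t::real. \<bar>t\<bar> powr p)) (symmetry_coeff (\<lambda>t::real. \<bar>t\<bar> powr q)) *
    power_bregman r y x \<le> power_bregman r x y" (is "min ?a ?b * _ \<le> _")
proof (cases "x = y")
  case True
  then show ?thesis by (simp add: bregman_def)
next
  case False
  have pos: "0 < power_bregman s y x" "0 < power_bregman s x y" if "1 < s" for s
    using power_bregman_pos[OF that] False by auto
  have nonneg: "0 \<le> power_bregman r y x"
    using pos assms by (simp add: less_imp_le)
  \<comment> \<open>A bound \<open>c\<close> on the ratio for \<open>s\<close> is passed on to \<open>r\<close> if the ratio for \<open>r\<close> is the larger one.\<close>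
  have compare: "c * power_bregman r y x \<le> power_bregman r x y"
    if "1 < s" "c * power_bregman s y x \<le> power_bregman s x y"
      "power_bregman s x y * power_bregman r y x \<le> power_bregman r x y * power_bregman s y x" for c s
  proof -
    have "(c * power_bregman r y x) * power_bregman s y x \<le> power_bregman r x y * power_bregman s y x"
      using mult_right_mono[OF that(2) nonneg] that(3) by (simp add: algebra_simps)
    then show ?thesis
      using pos[OF that(1)] by simp
  qed
  have "?a * power_bregman r y x \<le> power_bregman r x y \<or> ?b * power_bregman r y x \<le> power_bregman r x y"
  proof (cases "\<bar>y\<bar> \<le> \<bar>x\<bar>")
    case True
    have "?b * power_bregman r y x \<le> power_bregman r x y"
      using assms True
      by (intro compare[of q] symmetry_coeff_bound power_bregman_pos power_bregman_ratio_mono) auto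
    then show ?thesis ..
  next
    case False
    have "?a * power_bregman r y x \<le> power_bregman r x y"
      using assms False power_bregman_ratio_mono[of p r x y]
      by (intro compare[of p] symmetry_coeff_bound power_bregman_pos) (auto simp: algebra_simps)
    then show ?thesis ..
  qed
  moreover have "min ?a ?b * power_bregman r y x \<le> ?a * power_bregman r y x"
    "min ?a ?b * power_bregman r y x \<le> ?b * power_bregman r y x"
    using nonneg by (auto intro: mult_right_mono)
  ultimately show ?thesis
    by linarith
qed

section \<open>Powers of norms\<close>

lemma lr_norm_2: "lr_norm 2 x = norm x"
  by (simp add: lr_norm_def norm_vec_def L2_set_def powr_half_sqrt sum_nonneg)

lemma lr_norm_powr_self:
  assumes "0 < p"
  shows "lr_norm p x powr p = (\<Sum>j\<in>UNIV. \<bar>x $ j\<bar> powr p)"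
  using assms by (simp add: lr_norm_def powr_powr sum_nonneg)

lemma GDERIV_coordinate_powr:
  fixes y :: "real ^ 'n"
  assumes "1 < p"
  shows "\<exists>g. GDERIV (\<lambda>x. \<bar>x $ j\<bar> powr p) y :> g"
  using GDERIV_compose_inner[where e = "axis j 1 :: real ^ 'n", OF GDERIV_abs_powr[OF assms]]
  by (auto simp: inner_axis inner_real_def)

lemma bregman_coordinate_powr:
  fixes x y :: "real ^ 'n"
  assumes "1 < p"
  shows "bregman (\<lambda>x. \<bar>x $ j\<bar> powr p) x y = power_bregman p (x $ j) (y $ j)"
  using bregman_compose_inner[where e = "axis j 1 :: real ^ 'n", OF GDERIV_abs_powr[OF assms]]
  by (simp add: inner_axis inner_real_def)

lemma bregman_lr_norm_powr_self:
  fixes x y :: "real ^ 'n"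
  assumes "1 < p"
  shows "bregman (\<lambda>x. lr_norm p x powr p) x y = (\<Sum>j\<in>UNIV. power_bregman p (x $ j) (y $ j))"
  using assms bregman_sum[of UNIV "\<lambda>j x. \<bar>x $ j\<bar> powr p" "\<lambda>_. 1" x y]
  by (simp add: lr_norm_powr_self GDERIV_coordinate_powr bregman_coordinate_powr)

lemma GDERIV_lr_norm_powr:
  fixes y :: "real ^ 'n"
  assumes "1 < p" "r \<in> {2, p}"
  shows "\<exists>g. GDERIV (\<lambda>x. lr_norm r x powr p) y :> g"
proof (cases "r = 2")
  case True
  then show ?thesis
    using GDERIV_norm_powr[OF assms(1)] by (auto simp: lr_norm_2)
next
  case False
  have "\<forall>j. \<exists>g. GDERIV (\<lambda>x. \<bar>x $ j\<bar> powr p) y :> g"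
    by (intro allI GDERIV_coordinate_powr assms)
  then obtain g where "\<And>j. GDERIV (\<lambda>x. \<bar>x $ j\<bar> powr p) y :> g j"
    using choice[where Q = "\<lambda>j g. GDERIV (\<lambda>x. \<bar>x $ j\<bar> powr p) y :> g"] by blast
  then have "GDERIV (\<lambda>x. \<Sum>j\<in>UNIV. 1 * \<bar>x $ j\<bar> powr p) y :> (\<Sum>j\<in>UNIV. 1 *\<^sub>R g j)"
    by (rule GDERIV_sum)
  then show ?thesis
    using False assms by (auto simp: lr_norm_powr_self)
qed

lemma bregman_lr_norm_powr_pos:
  fixes x y :: "real ^ 'n"
  assumes "1 < p" "r \<in> {2, p}" "x \<noteq> y"
  shows "0 < bregman (\<lambda>x. lr_norm r x powr p) x y"
proof (cases "r = 2")
  case True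
  then show ?thesis
    using bregman_norm_powr_pos assms by (simp add: lr_norm_2)
next
  case False
  obtain j where "x $ j \<noteq> y $ j"
    using assms(3) by (auto simp: vec_eq_iff)
  then have "0 < (\<Sum>j\<in>UNIV. power_bregman p (x $ j) (y $ j))"
    using assms by (intro sum_pos2[of _ j] power_bregman_pos power_bregman_nonneg) auto
  then show ?thesis
    using False assms by (simp add: bregman_lr_norm_powr_self)
qed

lemma bregman_lr_norm_powr_symmetry:
  fixes x y :: "real ^ 'n"
  assumes "1 < p" "r \<in> {2, p}"
    and a: "\<And>s t. a * power_bregman p t s \<le> power_bregman p s t"
  shows "a * bregman (\<lambda>x. lr_norm r x powr p) y x \<le> bregman (\<lambda>x. lr_norm r x powr p) x y"
proof (cases "r = 2")
  case True
  then show ?thesis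
    using bregman_norm_powr_symmetry[OF assms(1) a] by (simp add: lr_norm_2)
next
  case False
  then show ?thesis
    using assms by (auto simp: bregman_lr_norm_powr_self sum_distrib_left intro!: sum_mono)
qed

lemma bregman_lr_norm_powr_axis:
  assumes "1 < p" "r \<in> {2, p}"
  shows "bregman (\<lambda>x. lr_norm r x powr p) (axis k s) (axis k t :: real ^ 'n) = power_bregman p s t"
proof (cases "r = 2")
  case True
  have "norm (axis k u :: real ^ 'n) = \<bar>u\<bar>" for u
    by (simp add: norm_eq_sqrt_inner inner_axis_axis)
  then show ?thesis
    using True assms by (simp add: lr_norm_2 bregman_norm_powr power_bregman_eq inner_axis_axis)
next
  case False
  then have "r = p"
    using assms by simp
  moreover have "power_bregman p (axis k s $ j) (axis k t $ j) =
      (if j = k then power_bregman p s t else 0)" for j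
    by (simp add: axis_def bregman_def)
  ultimately show ?thesis
    using assms by (simp add: bregman_lr_norm_powr_self)
qed

section \<open>Scaling limits\<close>

text \<open>Dividing by \<open>s\<close> to the power \<open>\<theta> k\<close> leaves \<open>A k\<close> and \<open>B k\<close> in the limit along \<open>F\<close>. The filter
  is left open so that the same argument serves \<open>s \<rightarrow> 0\<close>, where the smallest exponent dominates, and
  \<open>s \<rightarrow> \<infinity>\<close>, where the largest one does.\<close>

lemma dominant_term_le:
  fixes I :: "'i set" and A B \<theta> :: "'i \<Rightarrow> real"
  assumes "finite I" "k \<in> I" "F \<noteq> bot"
    and pos: "eventually (\<lambda>s. 0 < s) F"
    and vanish: "\<And>i. i \<in> I \<Longrightarrow> i \<noteq> k \<Longrightarrow> ((\<lambda>s. s powr (\<theta> i - \<theta> k)) \<longlongrightarrow> 0) F"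
    and le: "\<And>s. 0 < s \<Longrightarrow> (\<Sum>i\<in>I. s powr \<theta> i * A i) \<le> (\<Sum>i\<in>I. s powr \<theta> i * B i)"
  shows "A k \<le> B k"
proof -
  have lim: "((\<lambda>s. \<Sum>i\<in>I. s powr (\<theta> i - \<theta> k) * C i) \<longlongrightarrow> C k) F" for C
  proof -
    have "((\<lambda>s. s powr (\<theta> i - \<theta> k) * C i) \<longlongrightarrow> (if i = k then C k else 0)) F" if "i \<in> I" for i
    proof (cases "i = k")
      case True
      have "eventually (\<lambda>s. s powr (\<theta> i - \<theta> k) * C i = C k) F"
        by (rule eventually_mono[OF pos]) (use True in auto)
      then show ?thesis
        using True by (simp add: tendsto_eventually)
    next
      case False
      then show ?thesis
        using tendsto_mult_right[OF vanish[OF that False], of "C i"] by simp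
    qed
    then have "((\<lambda>s. \<Sum>i\<in>I. s powr (\<theta> i - \<theta> k) * C i) \<longlongrightarrow> (\<Sum>i\<in>I. if i = k then C k else 0)) F"
      by (rule tendsto_sum)
    then show ?thesis
      using assms by simp
  qed
  have "eventually (\<lambda>s. (\<Sum>i\<in>I. s powr (\<theta> i - \<theta> k) * A i) \<le> (\<Sum>i\<in>I. s powr (\<theta> i - \<theta> k) * B i)) F"
    using pos
  proof eventually_elim
    case (elim s)
    have "(\<Sum>i\<in>I. s powr (\<theta> i - \<theta> k) * C i) = (\<Sum>i\<in>I. s powr \<theta> i * C i) / s powr \<theta> k" for C
      by (simp add: powr_diff sum_divide_distrib)
    then show ?case
      using le[OF elim] by (simp add: divide_right_mono)
  qed
  then show ?thesis
    using tendsto_le[OF assms(3) lim lim] by blast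
qed

theorem theorem5p2:
  fixes m :: nat and p lam r :: "nat \<Rightarrow> real"
  assumes "m \<ge> 1"
    and "1 < p 1"
    and "\<And>i. 1 \<le> i \<Longrightarrow> i < m \<Longrightarrow> p i \<le> p (i + 1)"
    and "m \<ge> 2 \<Longrightarrow> p 1 < p 2"
    and "m \<ge> 2 \<Longrightarrow> p (m - 1) < p m"
    and "\<And>i. i \<in> {1..m} \<Longrightarrow> lam i > 0"
    and "\<And>i. i \<in> {1..m} \<Longrightarrow> r i \<in> {2, p i}"
  shows "symmetry_coeff (\<lambda>x :: real ^ 'n. \<Sum>i = 1..m. lam i * lr_norm (r i) x powr p i) =
    min (symmetry_coeff (\<lambda>t :: real. \<bar>t\<bar> powr p 1))
        (symmetry_coeff (\<lambda>t :: real. \<bar>t\<bar> powr p m))"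
proof -
  define h where "h = (\<lambda>i (x :: real ^ 'n). lr_norm (r i) x powr p i)"
  define H where "H = (\<lambda>x. \<Sum>i = 1..m. lam i * h i x)"
  have mono: "p i \<le> p j" if "1 \<le> i" "i \<le> j" "j \<le> m" for i j
    using that(2,3)
  proof (induction j rule: dec_induct)
    case (step j)
    then show ?case
      using assms(3)[of j] that(1) by simp
  qed simp
  have first: "p 1 < p i" if "i \<in> {1..m}" "i \<noteq> 1" for i
    using that assms(4) mono[of 2 i] by force
  have last: "p i < p m" if "i \<in> {1..m}" "i \<noteq> m" for i
    using that assms(5) mono[of i "m - 1"] by force
  have p1: "1 < p i" if "i \<in> {1..m}" for i
    using that assms(2) mono[of 1 i] by simp
  have breg: "bregman H x y = (\<Sum>i = 1..m. lam i * bregman (h i) x y)" for x y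
    unfolding H_def h_def
    by (rule bregman_sum) (intro GDERIV_lr_norm_powr p1 assms(7))
  have pos: "0 < bregman H x y" if "x \<noteq> y" for x y
    unfolding breg h_def using assms(1) that
    by (intro sum_pos mult_pos_pos bregman_lr_norm_powr_pos assms(6,7) p1) auto
  have axis: "bregman H (axis k (s * x)) (axis k (s * y)) =
      (\<Sum>i = 1..m. s powr p i * (lam i * power_bregman (p i) x y))" if "0 < s" for k s x y
    using that p1 assms(7) unfolding breg h_def
    by (intro sum.cong) (auto simp: bregman_lr_norm_powr_axis power_bregman_scale)
  \<comment> \<open>The coefficient of \<open>H\<close> is compared with that of a term dominating along some scaling limit.\<close>
  have upper: "symmetry_coeff H \<le> symmetry_coeff (\<lambda>t :: real. \<bar>t\<bar> powr p k)"
    if k: "k \<in> {1..m}" and F: "F \<noteq> bot" "eventually (\<lambda>s. 0 < s) F"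
      and vanish: "\<And>i. i \<in> {1..m} \<Longrightarrow> i \<noteq> k \<Longrightarrow> ((\<lambda>s. s powr (p i - p k)) \<longlongrightarrow> 0) F" for k F
  proof (rule symmetry_coeff_greatest)
    show "0 < power_bregman (p k) x y" if "x \<noteq> y" for x y
      using that p1[OF k] by (rule power_bregman_pos[rotated])
    fix x y :: real
    have "symmetry_coeff H * (lam k * power_bregman (p k) y x) \<le> lam k * power_bregman (p k) x y"
    proof (rule dominant_term_le[where I = "{1..m}" and \<theta> = p and F = F and k = k])
      fix s :: real assume s: "0 < s"
      show "(\<Sum>i = 1..m. s powr p i * (symmetry_coeff H * (lam i * power_bregman (p i) y x))) \<le>
          (\<Sum>i = 1..m. s powr p i * (lam i * power_bregman (p i) x y))"
        using symmetry_coeff_bound[of H "axis undefined (s * y)" "axis undefined (s * x)", OF pos]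
        by (simp add: axis[OF s] sum_distrib_left algebra_simps)
    qed (use k F vanish in auto)
    then show "symmetry_coeff H * power_bregman (p k) y x \<le> power_bregman (p k) x y"
      using assms(6)[OF k] by (simp add: algebra_simps)
  qed (rule zero_neq_one)
  have "symmetry_coeff H \<le> symmetry_coeff (\<lambda>t :: real. \<bar>t\<bar> powr p 1)"
  proof (rule upper[where F = "at_right 0"])
    fix i assume i: "i \<in> {1..m}" "i \<noteq> 1"
    show "((\<lambda>s. s powr (p i - p 1)) \<longlongrightarrow> 0) (at_right 0)"
      using first[OF i] by (intro tendsto_zero_powrI[where b = "p i - p 1"] tendsto_intros)
        (auto simp: eventually_at_right_less less_imp_le intro: eventually_mono[OF eventually_at_right_less])
  qed (use assms(1) in \<open>auto simp: eventually_at_right_less\<close>)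
  moreover have "symmetry_coeff H \<le> symmetry_coeff (\<lambda>t :: real. \<bar>t\<bar> powr p m)"
  proof (rule upper[where F = at_top])
    fix i assume i: "i \<in> {1..m}" "i \<noteq> m"
    show "((\<lambda>s. s powr (p i - p m)) \<longlongrightarrow> 0) at_top"
      using last[OF i] by (intro tendsto_neg_powr filterlim_ident) auto
  qed (use assms(1) in \<open>auto simp: eventually_gt_at_top\<close>)
  \<comment> \<open>Every exponent lies between \<open>p 1\<close> and \<open>p m\<close>, so the bound holds for each summand of \<open>H\<close>.\<close>
  moreover have "min (symmetry_coeff (\<lambda>t :: real. \<bar>t\<bar> powr p 1))
      (symmetry_coeff (\<lambda>t :: real. \<bar>t\<bar> powr p m)) \<le> symmetry_coeff H" (is "?a \<le> _")
  proof (rule symmetry_coeff_greatest[OF pos])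
    fix x y
    have "?a * bregman (h i) y x \<le> bregman (h i) x y" if i: "i \<in> {1..m}" for i
      unfolding h_def
      using i mono[of 1 i] mono[of i m] assms(2)
      by (intro bregman_lr_norm_powr_symmetry power_bregman_symmetry_between p1 assms(7)) auto
    then have "lam i * (?a * bregman (h i) y x) \<le> lam i * bregman (h i) x y" if "i \<in> {1..m}" for i
      using that assms(6) by (intro mult_left_mono) (auto simp: less_imp_le)
    then have "(\<Sum>i = 1..m. lam i * (?a * bregman (h i) y x)) \<le> (\<Sum>i = 1..m. lam i * bregman (h i) x y)"
      by (intro sum_mono)
    then show "?a * bregman H y x \<le> bregman H x y"
      unfolding breg sum_distrib_left by (simp only: mult.left_commute)
  next
    show "axis undefined 1 \<noteq> (0 :: real ^ 'n)"
      by (simp add: axis_eq_0_iff)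
  qed auto
  ultimately have "symmetry_coeff H = ?a"
    by simp
  then show ?thesis
    by (simp add: H_def h_def)
qed

end
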